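(* Let $\mathbf{K}$ be a field of arbitrary characteristic, and let $V_1,V_2\in\mathbf{K}[x,y]$ be coprime, $y$-primitive polynomials with $0<\deg_y V_2\le \deg_y V_1$. Let $n\ge 1$, let $V_3,\dots,V_{n+1}\in\mathbf{K}[x,y]$ be $y$-primitive polynomials with $0<\deg_y V_{n+1}<\dots<\deg_y V_3<\deg_y V_2$, put $V_{n+2}=1$, and let $Q_1,\dots,Q_n\in\mathbf{K}[x,y]$ and non-zero $u_1,\dots,u_n,v_1,\dots,v_n\in\mathbf{K}[x]$ be such that $$u_iV_i=Q_iV_{i+1}+v_iV_{i+2}\qquad\text{for } i=1,\dots,n.$$ Define $d_1=\gcd(u_1,v_1)$, $w_1=\frac{u_1}{d_1}$, and, for $i\in\{2,\dots,n\}$, $d_i=\gcd(w_{i-1}u_i,v_i)$, $w_i=\frac{w_{i-1}u_i}{d_i}$ (all in $\mathbf{K}[x]$). Then $$\{V_1=0,\,V_2=0\}=\bigcup_{i=1}^n\left\{V_{i+1}=0,\ \frac{v_i}{d_i}=0\right\}.$$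
   Context: For $W\in\mathbf{K}[x,y]$, $\deg_y W$ denotes the degree of $W$ with respect to $y$. A non-zero polynomial $W\in\mathbf{K}[x,y]$ is called $y$-primitive if it is primitive as an element of $\mathbf{K}[x][y]$, i.e. the greatest common divisor in $\mathbf{K}[x]$ of its non-zero coefficients (which are polynomials in $x$) is $1$. Polynomials in $\mathbf{K}[x]$ are regarded as elements of $\mathbf{K}[x,y]$. For $V,W\in\mathbf{K}[x,y]$, $\{V=0,W=0\}=\{P\in\mathbf{K}^2: V(P)=W(P)=0\}$. The data $V_3,\dots,V_{n+1},Q_i,u_i,v_i$ are those produced by the Euclidean algorithm (pseudo-division with respect to $y$) on input $(V_1,V_2)$, and $n$ is called its number of steps; when $n=1$ the list $V_3,\dots,V_{n+1}$ is empty and the single relation is $u_1V_1=Q_1V_2+v_1$. Greatest common divisors in $\mathbf{K}[x]$ are defined up to a non-zero constant; any choice may be made. *)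

theory Defs
  imports "HOL-Computational_Algebra.Polynomial"
begin

text \<open>
  \<open>K[x,y] = K[x][y]\<close> is represented by \<^typ>\<open>'a poly poly\<close>: the inner variable is \<open>x\<close>, the outer
  one is \<open>y\<close>. Hence \<open>deg\<^sub>y W\<close> is \<open>degree W\<close>, and \<open>u\<close> in \<open>K[x]\<close> is the constant polynomial \<open>[:u:]\<close>.
\<close>

text \<open>
  The class-based \<open>gcd\<close> on \<^typ>\<open>'a poly\<close> is not available for an arbitrary field \<^typ>\<open>'a\<close>. The
  relation below says that \<open>d\<close> is one of the (associated) greatest common divisors of \<open>A\<close>.
\<close>

definition is_gcd :: "'a::comm_semiring_1 \<Rightarrow> 'a set \<Rightarrow> bool" where
  "is_gcd d A \<longleftrightarrow> (\<forall>a\<in>A. d dvd a) \<and> (\<forall>c. (\<forall>a\<in>A. c dvd a) \<longrightarrow> c dvd d)"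

definition y_primitive :: "'a::field poly poly \<Rightarrow> bool" where
  "y_primitive W \<longleftrightarrow> W \<noteq> 0 \<and> is_gcd 1 {coeff W j | j. coeff W j \<noteq> 0}"

definition eval_xy :: "'a::field poly poly \<Rightarrow> 'a \<times> 'a \<Rightarrow> 'a" where
  "eval_xy W P = poly (poly W [:snd P:]) (fst P)"

definition common_zeros :: "'a::field poly poly \<Rightarrow> 'a poly poly \<Rightarrow> ('a \<times> 'a) set" where
  "common_zeros V W = {P. eval_xy V P = 0 \<and> eval_xy W P = 0}"

end

theory Submission
  imports Defs "HOL-Computational_Algebra.Polynomial_Factorial"
begin

text \<open>
  Write \<open>q\<^sub>i = v\<^sub>i / d\<^sub>i\<close>. Multiplying the steps of the algorithm together expresses \<open>(V\<^sub>1, V\<^sub>2)\<close> through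
  the consecutive pair \<open>(V\<^sub>k\<^sub>+\<^sub>1, V\<^sub>k\<^sub>+\<^sub>2)\<close>, with denominator \<open>u\<^sub>1 \<cdots> u\<^sub>k\<close>. Such a denominator can have zeros
  in common with \<open>q\<^sub>k\<close>, and then it gives no information there. The role of \<open>d\<^sub>k\<close> is to cancel these
  zeros: \<open>d\<^sub>k\<close> divides all terms but one of the combined relation, and in the remaining one it is
  multiplied by the primitive polynomial \<open>V\<^sub>k\<^sub>+\<^sub>1\<close>, so Gauss's lemma (\<open>const_dvd_mult_primitive_cancel\<close>)
  allows the division. The outcome (\<open>pseudo_remainder_matrix\<close>) is a system with reduced denominator
  \<open>w\<^sub>k V\<^sub>1 = A V\<^sub>k\<^sub>+\<^sub>1 + B V\<^sub>k\<^sub>+\<^sub>2\<close>, \<open>w\<^sub>k V\<^sub>2 = C V\<^sub>k\<^sub>+\<^sub>1 + D V\<^sub>k\<^sub>+\<^sub>2\<close>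
  in which \<open>q\<^sub>k\<close> divides \<open>B\<close> and \<open>D\<close>. Its determinant is \<open>\<plusminus> w\<^sub>k q\<^sub>1 \<cdots> q\<^sub>k\<close>, so multiplying by the adjugate
  matrix and cancelling \<open>w\<^sub>k\<close> shows that \<open>q\<^sub>1 \<cdots> q\<^sub>k V\<^sub>k\<^sub>+\<^sub>1\<close> and \<open>q\<^sub>1 \<cdots> q\<^sub>k V\<^sub>k\<^sub>+\<^sub>2\<close> lie in the ideal
  \<open>(V\<^sub>1, V\<^sub>2)\<close>.

  If \<open>V\<^sub>k\<^sub>+\<^sub>1\<close> and \<open>q\<^sub>k\<close> vanish at a point, then by the system so do \<open>w\<^sub>k V\<^sub>1\<close> and \<open>w\<^sub>k V\<^sub>2\<close>; the factor
  \<open>w\<^sub>k\<close> does not vanish there, being coprime to \<open>q\<^sub>k\<close>. Conversely, at a common zero of \<open>V\<^sub>1\<close> and \<open>V\<^sub>2\<close>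
  the ideal membership for \<open>k = n\<close> and \<open>V\<^sub>n\<^sub>+\<^sub>2 = 1\<close> make some \<open>q\<^sub>i\<close> vanish. For the least such \<open>i\<close> the
  product \<open>q\<^sub>1 \<cdots> q\<^sub>i\<^sub>-\<^sub>1\<close> is non-zero at the point, and membership of \<open>q\<^sub>1 \<cdots> q\<^sub>i\<^sub>-\<^sub>1 V\<^sub>i\<^sub>+\<^sub>1\<close> in the ideal
  gives \<open>V\<^sub>i\<^sub>+\<^sub>1 = 0\<close>.
\<close>

lemma eval_xy_simps [simp]:
  "eval_xy (V + W) P = eval_xy V P + eval_xy W P"
  "eval_xy (V - W) P = eval_xy V P - eval_xy W P"
  "eval_xy (V * W) P = eval_xy V P * eval_xy W P"
  "eval_xy (- W) P = - eval_xy W P"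
  "eval_xy (W ^ m) P = eval_xy W P ^ m"
  "eval_xy [:c:] P = poly c (fst P)"
  "eval_xy 1 P = 1"
  by (simp_all add: eval_xy_def)

lemma const_dvd_y_primitive_imp_unit:
  assumes "y_primitive W" "[:c:] dvd W"
  shows "is_unit c"
  using assms unfolding y_primitive_def is_gcd_def by (auto simp: const_poly_dvd_iff)

text \<open>
  This is Gauss's lemma in divisibility form. An irreducible \<open>c\<close> is prime in \<open>K[x]\<close>, and it stays
  prime as a constant of \<open>K[x][y]\<close>; a reducible \<open>c\<close> is cancelled one factor at a time.
\<close>

lemma const_dvd_mult_primitive_cancel:
  fixes c :: "'a::field poly"
  assumes "y_primitive W" "c \<noteq> 0" "[:c:] dvd F * W"
  shows "[:c:] dvd F"
  using assms(2,3)
proof (induction "degree c" arbitrary: c F rule: less_induct)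
  case less
  consider "is_unit c" | "irreducible c" | p q where "c = p * q" "\<not> is_unit p" "\<not> is_unit q"
    using less.prems(1) by (auto simp: irreducible_def)
  then show ?case
  proof cases
    case 1
    then have "is_unit [:c:]" by (simp add: is_unit_const_poly_iff)
    then show ?thesis by (rule unit_imp_dvd)
  next
    case 2
    then have "prime_elem c" by (rule field_poly_irreducible_imp_prime)
    then have "[:c:] dvd F \<or> [:c:] dvd W"
      using less.prems(2) lift_prime_elem_poly prime_elem_dvd_multD by blast
    moreover have "\<not> [:c:] dvd W"
      using 2 const_dvd_y_primitive_imp_unit[OF assms(1)] irreducible_not_unit by blast
    ultimately show ?thesis by blast
  next
    case (3 p q)
    from 3 less.prems(1) have nz: "p \<noteq> 0" "q \<noteq> 0" by auto
    with 3 have "degree p > 0" "degree q > 0"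
      by (auto simp: is_unit_iff_degree)
    with nz have deg: "degree p < degree c" "degree q < degree c"
      by (simp_all add: 3(1) degree_mult_eq)
    have c: "[:c:] = [:p:] * [:q:]" by (simp add: 3(1))
    have "[:p:] dvd F * W" using less.prems(2) unfolding c by (rule dvd_mult_left)
    then have "[:p:] dvd F" using less.hyps deg nz by blast
    then obtain G where G: "F = [:p:] * G" by (rule dvdE)
    have "[:p:] * [:q:] dvd [:p:] * (G * W)"
      using less.prems(2) unfolding c G by (simp only: mult.assoc)
    then have "[:q:] dvd G * W"
      using nz by (simp only: dvd_mult_cancel_left) simp
    then have "[:q:] dvd G" using less.hyps deg nz by blast
    then show ?thesis unfolding c G by (rule mult_dvd_mono[OF dvd_refl])
  qed
qed

text \<open>
  A common zero \<open>x\<^sub>0\<close> of the cofactors would make \<open>d (x - x\<^sub>0)\<close> a common divisor too large to divide \<open>d\<close>.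
\<close>

lemma is_gcd_cofactors_no_common_zero:
  fixes a b d :: "'a::field poly"
  assumes "is_gcd d {d * a, d * b}" "d \<noteq> 0" "poly b x = 0"
  shows "poly a x \<noteq> 0"
proof
  assume "poly a x = 0"
  with assms(3) have "d * [:- x, 1:] dvd d * a" "d * [:- x, 1:] dvd d * b"
    by (simp_all only: poly_eq_0_iff_dvd mult_dvd_mono dvd_refl)
  then have "d * [:- x, 1:] dvd d * 1"
    using assms(1) unfolding is_gcd_def mult_1_right by blast
  then have "[:- x, 1:] dvd 1" using assms(2) by (simp only: dvd_mult_cancel_left) simp
  then show False by (simp add: is_unit_iff_degree)
qed

text \<open>
  One step of the algorithm is substituted into a relation \<open>w F = A X + B W\<close>, after which the
  denominator is reduced by \<open>d\<close>. Primitivity of \<open>W\<close> is what makes \<open>d\<close> divide the new coefficient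
  \<open>A Q + u B\<close> of \<open>W\<close>. The first equation keeps the link of \<open>A'\<close> with \<open>A\<close> and \<open>B\<close>, from which the
  adjugate equations of the next lemma are obtained.
\<close>

lemma reduced_substitution:
  fixes F X W Y A B Q :: "'a::field poly poly" and d q u v w w' :: "'a poly"
  assumes "y_primitive W" "d \<noteq> 0"
    and rel: "[:w:] * F = A * X + B * W"
    and step: "[:u:] * X = Q * W + [:v:] * Y"
    and w': "d * w' = w * u" and q: "d * q = v"
  obtains A' where "[:d:] * A' = A * Q + [:u:] * B"
    and "[:w':] * F = A' * W + [:q:] * A * Y"
proof -
  have wu: "[:w:] * [:u:] = [:d:] * [:w':]" by (simp add: w' mult.commute)
  have v: "[:v:] = [:d:] * [:q:]" by (simp add: mult.commute flip: q)
  have "(A * Q + [:u:] * B) * W + [:v:] * A * Y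
        = A * ([:u:] * X) + [:u:] * B * W"
    unfolding step by (simp only: algebra_simps)
  also have "\<dots> = [:u:] * ([:w:] * F)"
    unfolding rel by (simp only: algebra_simps)
  also have "\<dots> = ([:w:] * [:u:]) * F"
    by (simp only: mult.left_commute mult.assoc)
  also have "\<dots> = [:d:] * ([:w':] * F)"
    unfolding wu by (simp only: mult.assoc)
  finally have eq: "(A * Q + [:u:] * B) * W = [:d:] * ([:w':] * F - [:q:] * A * Y)"
    unfolding v by (simp only: algebra_simps)
  then have "[:d:] dvd (A * Q + [:u:] * B) * W" by (simp only: dvd_triv_left)
  then have "[:d:] dvd A * Q + [:u:] * B"
    using const_dvd_mult_primitive_cancel assms(1,2) by blast
  then obtain A' where A': "A * Q + [:u:] * B = [:d:] * A'" by (rule dvdE)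
  have "[:d:] * (A' * W) = [:d:] * ([:w':] * F - [:q:] * A * Y)"
    using eq unfolding A' by (simp only: mult.assoc)
  then have "A' * W = [:w':] * F - [:q:] * A * Y"
    using assms(2) by (simp only: mult_cancel_left) simp
  then show thesis using that[OF A'[symmetric]] by (simp only: algebra_simps)
qed

text \<open>
  The last two equations are the adjugate of the first two with the factor \<open>w\<^sub>k\<close> cancelled. They are
  carried along in the induction, where they follow from the recursion \<open>d A' = A Q + u B\<close>; deducing
  them from the determinant would need this recursion as well. The convention \<open>w\<^sub>0 = 1\<close> turns
  \<open>k = 0\<close> into the identity matrix.
\<close>

lemma pseudo_remainder_matrix:
  fixes V Q :: "nat \<Rightarrow> 'a::field poly poly" and u v d q w :: "nat \<Rightarrow> 'a poly"
  assumes "w 0 = 1"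
    and "\<forall>i\<in>{1..n}. y_primitive (V (i+1))"
    and "\<forall>i\<in>{1..n}. [:u i:] * V i = Q i * V (i+1) + [:v i:] * V (i+2)"
    and "\<forall>i\<in>{1..n}. d i \<noteq> 0"
    and "\<forall>i\<in>{1..n}. d i * w i = w (i-1) * u i"
    and "\<forall>i\<in>{1..n}. d i * q i = v i"
    and "k \<le> n"
  shows "\<exists>A B C D. [:w k:] * V 1 = A * V (k+1) + B * V (k+2)
    \<and> [:w k:] * V 2 = C * V (k+1) + D * V (k+2)
    \<and> (1 \<le> k \<longrightarrow> [:q k:] dvd B \<and> [:q k:] dvd D)
    \<and> A * V 2 - C * V 1 = (-1) ^ k * [:\<Prod>i=1..k. q i:] * V (k+2)
    \<and> D * V 1 - B * V 2 = (-1) ^ k * [:\<Prod>i=1..k. q i:] * V (k+1)"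
  using assms(7)
proof (induction k)
  case 0
  show ?case
    by (rule exI[of _ 1], rule exI[of _ 0], rule exI[of _ 0], rule exI[of _ 1])
       (simp add: assms(1) numeral_2_eq_2 flip: one_pCons)
next
  case (Suc k)
  let ?i = "Suc k"
  define s where "s = (-1) ^ k * [:\<Prod>i=1..k. q i:]"
  obtain A B C D where IH: "[:w k:] * V 1 = A * V ?i + B * V (Suc ?i)"
    "[:w k:] * V 2 = C * V ?i + D * V (Suc ?i)"
    "A * V 2 - C * V 1 = s * V (Suc ?i)" "D * V 1 - B * V 2 = s * V ?i"
    unfolding s_def using Suc by auto
  have i: "?i \<in> {1..n}" using Suc.prems by simp
  have prim: "y_primitive (V (Suc ?i))" using bspec[OF assms(2) i] by simp
  have step: "[:u ?i:] * V ?i = Q ?i * V (Suc ?i) + [:v ?i:] * V (Suc (Suc ?i))"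
    using bspec[OF assms(3) i] by simp
  have dw: "d ?i * w ?i = w k * u ?i" using bspec[OF assms(5) i] by simp
  note d0 = bspec[OF assms(4) i] and dq = bspec[OF assms(6) i]
  obtain A' where A': "[:d ?i:] * A' = A * Q ?i + [:u ?i:] * B"
    "[:w ?i:] * V 1 = A' * V (Suc ?i) + [:q ?i:] * A * V (Suc (Suc ?i))"
    using reduced_substitution[OF prim d0 IH(1) step dw dq] .
  obtain C' where C': "[:d ?i:] * C' = C * Q ?i + [:u ?i:] * D"
    "[:w ?i:] * V 2 = C' * V (Suc ?i) + [:q ?i:] * C * V (Suc (Suc ?i))"
    using reduced_substitution[OF prim d0 IH(2) step dw dq] .
  have s': "(-1) ^ ?i * [:\<Prod>i=1..?i. q i:] = - (s * [:q ?i:])"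
    by (simp add: s_def mult.commute)
  have v: "[:v ?i:] = [:d ?i:] * [:q ?i:]" by (simp add: mult.commute flip: dq)
  have "[:d ?i:] * (A' * V 2 - C' * V 1) = ([:d ?i:] * A') * V 2 - ([:d ?i:] * C') * V 1"
    by (simp only: algebra_simps)
  also have "\<dots> = Q ?i * (A * V 2 - C * V 1) - [:u ?i:] * (D * V 1 - B * V 2)"
    unfolding A'(1) C'(1) by (simp only: algebra_simps)
  also have "\<dots> = s * (Q ?i * V (Suc ?i) - [:u ?i:] * V ?i)"
    unfolding IH(3,4) by (simp only: algebra_simps)
  also have "\<dots> = [:d ?i:] * (- (s * [:q ?i:]) * V (Suc (Suc ?i)))"
    unfolding step v by (simp add: algebra_simps)
  finally have det1: "A' * V 2 - C' * V 1 = - (s * [:q ?i:]) * V (Suc (Suc ?i))"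
    using d0 by (simp only: mult_cancel_left) simp
  have "[:q ?i:] * C * V 1 - [:q ?i:] * A * V 2 = - ([:q ?i:] * (A * V 2 - C * V 1))"
    by (simp add: algebra_simps)
  also have "\<dots> = - (s * [:q ?i:]) * V (Suc ?i)"
    unfolding IH(3) by (simp add: algebra_simps)
  finally have det2: "[:q ?i:] * C * V 1 - [:q ?i:] * A * V 2 = - (s * [:q ?i:]) * V (Suc ?i)" .
  have idx: "?i + 1 = Suc ?i" "?i + 2 = Suc (Suc ?i)" by simp_all
  show ?case
    unfolding idx s'
    by (rule exI[of _ A'], rule exI[of _ "[:q ?i:] * A"], rule exI[of _ C'],
        rule exI[of _ "[:q ?i:] * C"], intro conjI impI A'(2) C'(2) det1 det2)
       (simp_all only: mult.assoc dvd_triv_left)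
qed

theorem theorem2p1:
  fixes V Q :: "nat \<Rightarrow> 'a::field poly poly"
    and u v d w :: "nat \<Rightarrow> 'a poly"
    and n :: nat
  assumes "coprime (V 1) (V 2)"
    and "y_primitive (V 1)" and "y_primitive (V 2)"
    and "0 < degree (V 2)" and "degree (V 2) \<le> degree (V 1)"
    and "1 \<le> n"
    and "\<forall>i\<in>{3..n+1}. y_primitive (V i)"
    and "0 < degree (V (n+1))"
    and "\<forall>i\<in>{2..n}. degree (V (i+1)) < degree (V i)"
    and "V (n+2) = 1"
    and "\<forall>i\<in>{1..n}. u i \<noteq> 0 \<and> v i \<noteq> 0"
    and "\<forall>i\<in>{1..n}. [:u i:] * V i = Q i * V (i+1) + [:v i:] * V (i+2)"
    and "is_gcd (d 1) {u 1, v 1}" and "w 1 = u 1 div d 1"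
    and "\<forall>i\<in>{2..n}. is_gcd (d i) {w (i-1) * u i, v i} \<and> w i = (w (i-1) * u i) div d i"
  shows "common_zeros (V 1) (V 2) = (\<Union>i\<in>{1..n}. common_zeros (V (i+1)) [:v i div d i:])"
proof -
  \<comment> \<open>Setting \<open>w\<^sub>0 = 1\<close> makes the first step an instance of the general one.\<close>
  define w' where "w' = w(0 := 1)"
  define q where "q = (\<lambda>i. v i div d i)"
  have prim: "\<forall>i\<in>{1..n}. y_primitive (V (i+1))"
  proof
    fix i assume "i \<in> {1..n}"
    then show "y_primitive (V (i+1))"
      using assms(3,7) by (cases "i = 1") (simp_all add: numeral_2_eq_2)
  qed
  have gcd: "is_gcd (d i) {w' (i-1) * u i, v i}" "w' i = (w' (i-1) * u i) div d i"
    if "i \<in> {1..n}" for i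
  proof -
    have "is_gcd (d i) {w' (i-1) * u i, v i} \<and> w' i = (w' (i-1) * u i) div d i"
    proof (cases "i = 1")
      case True
      then show ?thesis using assms(13,14) by (simp add: w'_def)
    next
      case False
      with that have "i \<in> {2..n}" "w' i = w i" "w' (i-1) = w (i-1)"
        by (simp_all add: w'_def)
      then show ?thesis using assms(15) by metis
    qed
    then show "is_gcd (d i) {w' (i-1) * u i, v i}" "w' i = (w' (i-1) * u i) div d i"
      by blast+
  qed
  have dvd: "d i dvd w' (i-1) * u i" "d i dvd v i" if "i \<in> {1..n}" for i
    using gcd(1)[OF that] by (simp_all add: is_gcd_def)
  have dw: "\<forall>i\<in>{1..n}. d i * w' i = w' (i-1) * u i"
  proof
    fix i assume "i \<in> {1..n}"
    from dvd(1)[OF this] show "d i * w' i = w' (i-1) * u i"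
      unfolding gcd(2)[OF \<open>i \<in> {1..n}\<close>] by (rule dvd_mult_div_cancel)
  qed
  have dq: "\<forall>i\<in>{1..n}. d i * q i = v i"
    using dvd(2) by (simp add: q_def)
  have d0: "\<forall>i\<in>{1..n}. d i \<noteq> 0"
    using dvd(2) assms(11) by force
  have w'0: "w' 0 = 1" by (simp add: w'_def)
  note matrix = pseudo_remainder_matrix[OF w'0 prim assms(12) d0 dw dq]
  show ?thesis
  proof (intro equalityI subsetI)
    fix P assume "P \<in> common_zeros (V 1) (V 2)"
    then have P: "eval_xy (V 1) P = 0" "eval_xy (V 2) P = 0"
      by (simp_all add: common_zeros_def)
    have prod_zero: "(\<Prod>i=1..k. poly (q i) (fst P)) * eval_xy (V (k+2)) P = 0" if k: "k \<le> n" for k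
    proof -
      obtain A C where "A * V 2 - C * V 1 = (-1) ^ k * [:\<Prod>i=1..k. q i:] * V (k+2)"
        using matrix[OF k] by blast
      from arg_cong[OF this, of "\<lambda>W. eval_xy W P"]
      have "(-1) ^ k * (\<Prod>i=1..k. poly (q i) (fst P)) * eval_xy (V (k+2)) P = 0"
        by (simp only: eval_xy_simps P poly_prod) simp
      then show ?thesis by simp
    qed
    have "\<exists>i. i \<in> {1..n} \<and> poly (q i) (fst P) = 0"
      using prod_zero[of n] assms(10) by auto
    then obtain i where i: "i \<in> {1..n} \<and> poly (q i) (fst P) = 0"
      and least: "\<forall>j<i. \<not> (j \<in> {1..n} \<and> poly (q j) (fst P) = 0)"
      by (subst (asm) exists_least_iff) blast
    have "poly (q j) (fst P) \<noteq> 0" if "j \<in> {1..i-1}" for j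
    proof -
      have "j < i" "j \<in> {1..n}" using that i by auto
      then show ?thesis using least by blast
    qed
    then have "(\<Prod>j=1..i-1. poly (q j) (fst P)) \<noteq> 0" by simp
    moreover have "i - 1 + 2 = i + 1" "i - 1 \<le> n" using i by auto
    ultimately have "eval_xy (V (i+1)) P = 0" using prod_zero[of "i-1"] by simp
    with i show "P \<in> (\<Union>i\<in>{1..n}. common_zeros (V (i+1)) [:v i div d i:])"
      by (auto simp: common_zeros_def q_def)
  next
    fix P assume "P \<in> (\<Union>i\<in>{1..n}. common_zeros (V (i+1)) [:v i div d i:])"
    then obtain i where i: "i \<in> {1..n}" and P: "eval_xy (V (i+1)) P = 0" "poly (q i) (fst P) = 0"
      by (auto simp: common_zeros_def q_def)
    have "is_gcd (d i) {d i * w' i, d i * q i}"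
      using gcd(1)[OF i] dw dq i by simp
    then have w: "poly (w' i) (fst P) \<noteq> 0"
      using is_gcd_cofactors_no_common_zero d0 i P(2) by blast
    obtain A B C D where
      eqs: "[:w' i:] * V 1 = A * V (i+1) + B * V (i+2)" "[:w' i:] * V 2 = C * V (i+1) + D * V (i+2)"
      and "[:q i:] dvd B" "[:q i:] dvd D"
      using matrix[of i] i by auto
    then have "eval_xy B P = 0" "eval_xy D P = 0"
      using P(2) by (auto simp only: dvd_def eval_xy_simps mult_zero_left)
    then show "P \<in> common_zeros (V 1) (V 2)"
      using arg_cong[OF eqs(1), of "\<lambda>W. eval_xy W P"] arg_cong[OF eqs(2), of "\<lambda>W. eval_xy W P"] P w
      by (simp only: eval_xy_simps common_zeros_def) simp
  qed
qed

end
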